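(* Let $n\geqslant 4$. Every vertex of the Bubble-sort graph $BS_n$ belongs to exactly $(n-2)(n-3)/2$ distinct $4$-cycles, and every $4$-cycle of $BS_n$ has the canonical form $$C_4=(b_j\,b_i)^2=b_j\,b_i\,b_j\,b_i,\qquad 1\leqslant i<j-1\leqslant n-2.$$ In total, $BS_n$ contains $\frac{(n-2)(n-3)\,n!}{8}$ distinct $4$-cycles.
   Context: For $n\geqslant 2$, $Sym_n$ is the symmetric group of permutations $\pi=[\pi_1\pi_2\ldots\pi_n]$ of $\{1,\dots,n\}$. For $1\leqslant i\leqslant n-1$ let $b_i=(i\ i+1)$; multiplying $\pi$ on the right by $b_i$ swaps the entries in positions $i$ and $i+1$. The Bubble-sort graph $BS_n$ is the Cayley graph $Cay(Sym_n,\{b_1,\dots,b_{n-1}\})$: vertices are the permutations, and $\pi$ is adjacent to $\pi b_i$ for each $i$. A form of an $\ell$-cycle is a sequence $b_{i_0}b_{i_1}\cdots b_{i_{\ell-1}}$ with $i_j\neq i_{j+1}$ (indices cyclic) such that starting at a vertex $\pi$ and successively multiplying on the right by $b_{i_0},b_{i_1},\dots$ traces the cycle and returns to $\pi$, i.e. $\pi b_{i_0}\cdots b_{i_{\ell-1}}=\pi$. Each $\ell$-cycle has $2\ell$ forms (choice of starting vertex and direction); its canonical form is the one whose index sequence $i_0\ldots i_{\ell-1}$ is lexicographically maximal. $(b_ab_b)^k$ denotes the word $b_ab_b$ repeated $k$ times. *)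

theory Defs
  imports "HOL-Algebra.Sym_Groups" Complex_Main
begin

text \<open>A simple graph is a pair of a vertex set and a set of two-element edges.\<close>

type_synonym 'a graph = "'a set \<times> 'a set set"

abbreviation verts :: "'a graph \<Rightarrow> 'a set" where
  "verts \<equiv> fst"

abbreviation edges :: "'a graph \<Rightarrow> 'a set set" where
  "edges \<equiv> snd"

definition cayley_graph :: "('a, 'b) monoid_scheme \<Rightarrow> 'a set \<Rightarrow> 'a graph" where
  "cayley_graph G S = (carrier G, {{g, g \<otimes>\<^bsub>G\<^esub> s} | g s. g \<in> carrier G \<and> s \<in> S})"

text \<open>The product of \<^const>\<open>sym_group\<close> is composition, so the entry of \<open>\<pi> \<otimes> bubble i\<close> at
  position \<open>k\<close> is \<open>\<pi> (bubble i k)\<close>: right multiplication swaps the entries at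
  positions \<open>i\<close> and \<open>i + 1\<close>.\<close>

definition bubble :: "nat \<Rightarrow> nat \<Rightarrow> nat" where
  "bubble i = transpose i (i + 1)"

definition bubble_sort_graph :: "nat \<Rightarrow> (nat \<Rightarrow> nat) graph" where
  "bubble_sort_graph n = cayley_graph (sym_group n) (bubble ` {1..n - 1})"

text \<open>A cycle is the subgraph traced by a closed walk without repeated vertices, so lists that
  differ only in the starting vertex or the direction give the same cycle.\<close>

definition cycle_of :: "'a list \<Rightarrow> 'a graph" where
  "cycle_of vs = (set vs, {{vs ! k, vs ! (Suc k mod length vs)} | k. k < length vs})"

definition cycles :: "nat \<Rightarrow> 'a graph \<Rightarrow> 'a graph set" where
  "cycles l H = {cycle_of vs | vs. 3 \<le> l \<and> length vs = l \<and> distinct vs \<and>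
     set vs \<subseteq> verts H \<and> edges (cycle_of vs) \<subseteq> edges H}"

text \<open>The word \<open>b\<^bsub>i\<^sub>0\<^esub> b\<^bsub>i\<^sub>1\<^esub> \<dots>\<close> is represented by its list of indices.\<close>

definition bubble_mult :: "nat \<Rightarrow> (nat \<Rightarrow> nat) \<Rightarrow> nat list \<Rightarrow> (nat \<Rightarrow> nat)" where
  "bubble_mult n \<pi> w = foldl (\<lambda>\<sigma> i. \<sigma> \<otimes>\<^bsub>sym_group n\<^esub> bubble i) \<pi> w"

definition bubble_walk :: "nat \<Rightarrow> (nat \<Rightarrow> nat) \<Rightarrow> nat list \<Rightarrow> (nat \<Rightarrow> nat) list" where
  "bubble_walk n \<pi> w = map (\<lambda>k. bubble_mult n \<pi> (take k w)) [0..<length w]"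

definition is_form :: "nat \<Rightarrow> (nat \<Rightarrow> nat) graph \<Rightarrow> nat list \<Rightarrow> bool" where
  "is_form n C w \<longleftrightarrow>
     set w \<subseteq> {1..n - 1} \<and>
     (\<forall>k < length w. w ! k \<noteq> w ! (Suc k mod length w)) \<and>
     (\<exists>\<pi> \<in> carrier (sym_group n). bubble_mult n \<pi> w = \<pi> \<and>
        distinct (bubble_walk n \<pi> w) \<and> cycle_of (bubble_walk n \<pi> w) = C)"

definition is_canonical_form :: "nat \<Rightarrow> (nat \<Rightarrow> nat) graph \<Rightarrow> nat list \<Rightarrow> bool" where
  "is_canonical_form n C w \<longleftrightarrow>
     is_form n C w \<and> (\<forall>w'. is_form n C w' \<longrightarrow> w' = w \<or> (w', w) \<in> lexord less_than)"

end

theory Submission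
  imports Defs
begin

text \<open>A 4-cycle corresponds to a word \<open>b\<^sub>i b\<^sub>j b\<^sub>k b\<^sub>l = 1\<close> with cyclically distinct neighbours.
  Comparing the points moved by \<open>b\<^sub>i b\<^sub>j\<close> and \<open>b\<^sub>l b\<^sub>k\<close> forces \<open>k = i\<close>, \<open>l = j\<close> and
  \<open>\<bar>i - j\<bar> \<ge> 2\<close>. So a 4-cycle is determined by any of its vertices and the unordered pair
  \<open>{i, j}\<close>, which can be read off the two edges at that vertex. There are
  \<open>(n - 2) (n - 3) / 2\<close> such pairs, and counting incidences of vertices and 4-cycles, four for
  every cycle, gives the total.\<close>

section \<open>Adjacent transpositions and their words of length four\<close>

lemma bubble_apply: "bubble i x = (if x = i then i + 1 else if x = i + 1 then i else x)"
  by (simp add: bubble_def transpose_def)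

lemma comp_bubble_bubble [simp]: "\<pi> \<circ> bubble i \<circ> bubble i = \<pi>"
  by (simp add: bubble_def comp_assoc)

lemma bubble_eq_iff [simp]: "bubble i = bubble j \<longleftrightarrow> i = j"
proof
  assume "bubble i = bubble j"
  then have "bubble i i = bubble j i" "bubble i j = bubble j j"
    by simp_all
  then show "i = j"
    by (simp add: bubble_apply split: if_splits)
qed simp

lemma bubble_neq_id: "bubble i \<noteq> id"
  by (metis bubble_apply id_apply n_not_Suc_n Suc_eq_plus1)

lemma bubble_commute:
  assumes "i + 1 < j"
  shows "bubble i \<circ> bubble j = bubble j \<circ> bubble i"
  using assms by (auto simp: fun_eq_iff bubble_apply)

lemma bubble_bubble_apply [simp]: "bubble i (bubble i x) = x"
  by (simp add: bubble_apply)

text \<open>Compare the smallest and the largest point moved by either side: for \<open>i < j\<close> the left-hand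
  side maps the smallest one, \<open>i\<close>, to \<open>i + 1\<close>, and the largest one, \<open>j + 1\<close>, is moved as well.\<close>

lemma bubble_comp_eqD:
  assumes eq: "\<And>x. bubble i (bubble j x) = bubble l (bubble k x)"
    and "i < j" "k \<noteq> l" "l \<noteq> i"
  shows "k = i \<and> l = j \<and> i + 1 < j"
proof -
  have i: "bubble i (bubble j i) = i + 1"
    using \<open>i < j\<close> by (simp add: bubble_apply)
  have fixed: "bubble a (bubble b x) = x" if "x < a \<and> x < b \<or> x > a + 1 \<and> x > b + 1" for a b x
    using that by (auto simp: bubble_apply)
  \<comment> \<open>For \<open>l < k\<close> the smallest point moved on the right is
    \<open>l\<close>, on the left it is \<open>i\<close>; these would have to agree, against
    \<open>l \<noteq> i\<close>.\<close>
  have "\<not> l < k"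
  proof
    assume "l < k"
    then have "bubble l (bubble k l) = l + 1"
      by (simp add: bubble_apply)
    with \<open>l < k\<close> \<open>l \<noteq> i\<close> \<open>i < j\<close> show False
      using i eq[of i] eq[of l] fixed[of i l k] fixed[of l i j] by linarith
  qed
  with \<open>k \<noteq> l\<close> have "k < l"
    by simp
  have k: "bubble l (bubble k k) \<noteq> k"
    using \<open>k < l\<close> by (simp add: bubble_apply)
  have "k = i"
    using i k eq[of i] eq[of k] fixed[of i l k] fixed[of k i j] \<open>k < l\<close> \<open>i < j\<close> by linarith
  \<comment> \<open>With \<open>k < l\<close> this makes \<open>l + 1\<close> the largest point
    moved on the right, to be matched with \<open>j + 1\<close> on the left.\<close>
  have top: "bubble b (bubble a (b + 1)) = b" if "a < b" for a b
    using that by (simp add: bubble_apply)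
  have j: "bubble i (bubble j (j + 1)) \<noteq> j + 1"
    using \<open>i < j\<close> by (simp add: bubble_apply)
  have "l = j"
    using top[OF \<open>k < l\<close>] j eq[of "j + 1"] eq[of "l + 1"] fixed[of "j + 1" l k]
      fixed[of "l + 1" i j] \<open>k < l\<close> \<open>i < j\<close> by linarith
  moreover have "j \<noteq> i + 1"
    using eq[of i] i by (auto simp: \<open>k = i\<close> \<open>l = j\<close> bubble_apply)
  ultimately show ?thesis
    using \<open>k = i\<close> \<open>i < j\<close> by simp
qed

text \<open>Moving the last two letters to the other side gives \<open>b_i b_j = b_l b_k\<close>;
  inverting gives \<open>b_j b_i = b_k b_l\<close>. Whichever of \<open>i\<close>, \<open>j\<close>
  is smaller, one of the two equations has the increasing left-hand side that
  \<open>bubble_comp_eqD\<close> demands.\<close>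

lemma bubble_word_eq_id:
  assumes eq: "bubble i \<circ> bubble j \<circ> bubble k \<circ> bubble l = id"
    and "i \<noteq> j" "j \<noteq> k" "k \<noteq> l" "l \<noteq> i"
  shows "k = i \<and> l = j \<and> (i + 1 < j \<or> j + 1 < i)"
proof -
  have word: "bubble i (bubble j (bubble k (bubble l x))) = x" for x
    using fun_cong[OF eq, of x] by simp
  have "bubble i (bubble j x) = bubble l (bubble k x)" for x
    using word[of "bubble l (bubble k x)"] by simp
  note fwd = bubble_comp_eqD[OF this]
  have "bubble j (bubble i x) = bubble k (bubble l x)" for x
    using arg_cong[OF word[of x], of "\<lambda>y. bubble j (bubble i y)"] by simp
  note bwd = bubble_comp_eqD[OF this]
  show ?thesis
    using fwd bwd assms(2-) by (cases "i < j") auto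
qed

section \<open>Counting pairs of commuting generators\<close>

text \<open>Ordering the components lists each unordered pair of distinct commuting generators
  once.\<close>

definition index_pairs :: "nat \<Rightarrow> (nat \<times> nat) set" where
  "index_pairs n = {(i, j). 1 \<le> i \<and> i + 1 < j \<and> j < n}"

lemma finite_index_pairs: "finite (index_pairs n)"
  by (rule finite_subset[of _ "{..n} \<times> {..n}"]) (auto simp: index_pairs_def)

text \<open>Passing from \<open>m\<close> to \<open>Suc m\<close> adds the pairs with second
  component \<open>m + 2\<close>, whose first component ranges over \<open>{1..m}\<close>. The
  doubling avoids a division, and the truncated \<open>m - 1\<close> does no harm at
  \<open>m = 0\<close>.\<close>

lemma card_index_pairs: "2 * card (index_pairs (m + 2)) = m * (m - 1)"
proof (induction m)
  case 0
  have "index_pairs (0 + 2) = {}"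
    by (auto simp: index_pairs_def)
  then show ?case
    by simp
next
  case (Suc m)
  have "index_pairs (Suc m + 2) = index_pairs (m + 2) \<union> (\<lambda>i. (i, m + 2)) ` {1..m}"
    by (auto simp: index_pairs_def)
  moreover have "index_pairs (m + 2) \<inter> (\<lambda>i. (i, m + 2)) ` {1..m} = {}"
    by (auto simp: index_pairs_def)
  ultimately have "card (index_pairs (Suc m + 2)) = card (index_pairs (m + 2)) + m"
    by (simp add: card_Un_disjoint finite_index_pairs card_image inj_on_def)
  with Suc.IH show ?case
    by (cases m) auto
qed

section \<open>Adjacency in the bubble-sort graph\<close>

lemma carrier_sym_group: "\<pi> \<in> carrier (sym_group n) \<longleftrightarrow> \<pi> permutes {1..n}"
  by (simp add: sym_group_def)

lemma bubble_permutes: "i \<in> {1..n - 1} \<Longrightarrow> bubble i permutes {1..n}"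
  unfolding bubble_def by (rule permutes_swap_id) auto

lemma verts_bubble_sort_graph [simp]: "verts (bubble_sort_graph n) = {\<pi>. \<pi> permutes {1..n}}"
  by (simp add: bubble_sort_graph_def cayley_graph_def sym_group_def)

text \<open>An edge does not record which endpoint was multiplied, but generators are involutions,
  so either endpoint arises from the other by the same generator.\<close>

lemma edge_bubble_sort_graph_iff:
  assumes "\<pi> permutes {1..n}"
  shows "{\<pi>, \<sigma>} \<in> edges (bubble_sort_graph n) \<longleftrightarrow> (\<exists>i\<in>{1..n - 1}. \<sigma> = \<pi> \<circ> bubble i)"
proof
  assume "{\<pi>, \<sigma>} \<in> edges (bubble_sort_graph n)"
  then obtain g i where "i \<in> {1..n - 1}" "{\<pi>, \<sigma>} = {g, g \<circ> bubble i}"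
    by (auto simp: bubble_sort_graph_def cayley_graph_def sym_group_def)
  moreover from this(2) have "\<sigma> = \<pi> \<circ> bubble i"
    by (auto simp: doubleton_eq_iff)
  ultimately show "\<exists>i\<in>{1..n - 1}. \<sigma> = \<pi> \<circ> bubble i"
    by blast
next
  assume "\<exists>i\<in>{1..n - 1}. \<sigma> = \<pi> \<circ> bubble i"
  with assms show "{\<pi>, \<sigma>} \<in> edges (bubble_sort_graph n)"
    by (auto simp: bubble_sort_graph_def cayley_graph_def sym_group_def)
qed

section \<open>Squares spanned by two generators at a vertex\<close>

lemma cycle_of_4:
  "cycle_of [a, b, c, d] = ({a, b, c, d}, {{a, b}, {b, c}, {c, d}, {d, a}})"
proof -
  have *: "{f k |k. k < 4} = {f 0, f 1, f 2, f (3::nat)}" for f :: "nat \<Rightarrow> 'a set"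
    by (auto simp: numeral_eq_Suc less_Suc_eq)
  have "length [a, b, c, d] = 4"
    by simp
  then show ?thesis
    unfolding cycle_of_def by (simp only: *) simp
qed

text \<open>The fourth vertex is written as a neighbour of \<pi>; it agrees with the walk's
  \<open>\<pi> \<circ> bubble i \<circ> bubble j \<circ> bubble i\<close> when the two generators
  commute.\<close>

definition square :: "(nat \<Rightarrow> nat) \<Rightarrow> nat \<Rightarrow> nat \<Rightarrow> (nat \<Rightarrow> nat) graph" where
  "square \<pi> i j = cycle_of [\<pi>, \<pi> \<circ> bubble i, \<pi> \<circ> bubble i \<circ> bubble j, \<pi> \<circ> bubble j]"

lemma permutes_comp_left_cancel:
  assumes "\<pi> permutes S"
  shows "\<pi> \<circ> f = \<pi> \<circ> g \<longleftrightarrow> f = g"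
  using permutes_inj[OF assms] by (auto simp: fun_eq_iff dest: injD)

lemma permutes_comp_left_cancel_id:
  assumes "\<pi> permutes S"
  shows "\<pi> \<circ> f = \<pi> \<longleftrightarrow> f = id"
  using permutes_comp_left_cancel[OF assms, of f id] by simp

lemma comp_bubble_neq:
  assumes "\<pi> permutes S"
  shows "\<pi> \<circ> bubble i \<noteq> \<pi>"
  using permutes_comp_left_cancel_id[OF assms] bubble_neq_id by blast

text \<open>Exchanging the two commuting generators traverses the same square in the opposite
  direction.\<close>

lemma square_swap:
  assumes "i + 1 < j"
  shows "square \<pi> j i = square \<pi> i j"
  using bubble_commute[OF assms]
  by (simp add: square_def cycle_of_4 comp_assoc insert_commute)

text \<open>Commutation lets any of the four vertices serve as the base point, so a square is
  recovered from any of its vertices and its two indices.\<close>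

lemma square_base:
  assumes "i + 1 < j" "\<sigma> \<in> verts (square \<pi> i j)"
  shows "square \<sigma> i j = square \<pi> i j"
proof -
  have comm: "\<pi> \<circ> bubble j \<circ> bubble i = \<pi> \<circ> bubble i \<circ> bubble j" for \<pi> :: "nat \<Rightarrow> nat"
    using bubble_commute[OF assms(1)] by (simp add: comp_assoc)
  have "\<sigma> \<in> {\<pi>, \<pi> \<circ> bubble i, \<pi> \<circ> bubble i \<circ> bubble j, \<pi> \<circ> bubble j}"
    using assms(2) by (simp add: square_def cycle_of_4)
  then show ?thesis
    by (elim insertE emptyE) (simp_all add: square_def cycle_of_4 comm insert_commute)
qed

text \<open>Left composition with \<pi> is injective, which reduces the claim to the base point
  \<open>id\<close>.\<close>

lemma square_distinct:
  assumes "\<pi> permutes S" "i \<noteq> j"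
  shows "distinct [\<pi>, \<pi> \<circ> bubble i, \<pi> \<circ> bubble i \<circ> bubble j, \<pi> \<circ> bubble j]"
proof -
  have "bubble i \<circ> bubble j \<noteq> id"
  proof
    assume "bubble i \<circ> bubble j = id"
    then have "bubble i \<circ> bubble j \<circ> bubble j = bubble j"
      by simp
    with assms(2) show False
      by (simp del: comp_apply)
  qed
  moreover have "bubble i \<circ> bubble j \<noteq> bubble j"
  proof
    assume "bubble i \<circ> bubble j = bubble j"
    then have "bubble i \<circ> bubble j \<circ> bubble j = id \<circ> bubble j \<circ> bubble j"
      by simp
    then show False
      using bubble_neq_id[of i] unfolding comp_bubble_bubble by simp
  qed
  moreover have "bubble i \<circ> bubble j \<noteq> bubble i"
    using permutes_comp_left_cancel_id[of "bubble i" "{i, i + 1}"] bubble_neq_id[of j]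
    by (simp add: bubble_def permutes_swap_id)
  ultimately have "distinct [id, bubble i, bubble i \<circ> bubble j, bubble j]"
    using assms(2) bubble_neq_id[of i] bubble_neq_id[of j] by (simp add: eq_commute)
  moreover have "inj ((\<circ>) \<pi>)"
    using permutes_comp_left_cancel[OF assms(1)] by (auto simp: inj_def)
  ultimately have "distinct (map ((\<circ>) \<pi>) [id, bubble i, bubble i \<circ> bubble j, bubble j])"
    by (auto simp only: distinct_map intro: inj_on_subset)
  then show ?thesis
    by (simp add: comp_assoc)
qed

text \<open>The labels of the two edges at \<pi> recover the index set; by distinctness the other
  two edges avoid \<pi>.\<close>

lemma square_inj:
  assumes "\<pi> permutes S" "i \<noteq> j" "i' \<noteq> j'" "square \<pi> i j = square \<pi> i' j'"
  shows "{i, j} = {i', j'}"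
proof -
  have nb: "{k. {\<pi>, \<pi> \<circ> bubble k} \<in> edges (square \<pi> i j)} = {i, j}" if "i \<noteq> j" for i j
    using square_distinct[OF assms(1) that] comp_bubble_neq[OF assms(1)]
    by (auto simp: square_def cycle_of_4 doubleton_eq_iff permutes_comp_left_cancel[OF assms(1)])
  show ?thesis
    using nb[OF assms(2)] nb[OF assms(3)] assms(4) by simp
qed

lemma permutes_comp_bubble:
  assumes "\<pi> permutes {1..n}" "i \<in> {1..n - 1}"
  shows "\<pi> \<circ> bubble i permutes {1..n}"
  using bubble_permutes[OF assms(2)] assms(1) by (rule permutes_compose)

section \<open>The 4-cycles are exactly the squares of commuting generators\<close>

lemma square_in_cycles:
  assumes "\<pi> permutes {1..n}" "(i, j) \<in> index_pairs n"
  shows "square \<pi> i j \<in> cycles 4 (bubble_sort_graph n)"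
proof -
  have ij: "i \<in> {1..n - 1}" "j \<in> {1..n - 1}" "i + 1 < j"
    using assms(2) by (auto simp: index_pairs_def)
  let ?vs = "[\<pi>, \<pi> \<circ> bubble i, \<pi> \<circ> bubble i \<circ> bubble j, \<pi> \<circ> bubble j]"
  have comm: "\<pi> \<circ> bubble i \<circ> bubble j = \<pi> \<circ> bubble j \<circ> bubble i"
    using bubble_commute[OF ij(3)] by (simp add: comp_assoc)
  have edge: "{\<sigma>, \<sigma> \<circ> bubble k} \<in> edges (bubble_sort_graph n)"
    if "\<sigma> permutes {1..n}" "k \<in> {1..n - 1}" for \<sigma> k
    using edge_bubble_sort_graph_iff[OF that(1)] that(2) by blast
  \<comment> \<open>This side of the square carries the label \<open>i\<close>, which becomes
    visible only after commuting the two generators.\<close>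
  have "{\<pi> \<circ> bubble j, \<pi> \<circ> bubble i \<circ> bubble j} \<in> edges (bubble_sort_graph n)"
    unfolding comm by (intro edge permutes_comp_bubble assms ij)
  then have "edges (cycle_of ?vs) \<subseteq> edges (bubble_sort_graph n)"
    using edge[OF assms(1) ij(1)] edge[OF assms(1) ij(2)]
      edge[OF permutes_comp_bubble[OF assms(1) ij(1)] ij(2)]
    by (simp add: cycle_of_4 insert_commute)
  moreover have "set ?vs \<subseteq> verts (bubble_sort_graph n)"
    using permutes_comp_bubble[OF assms(1)] permutes_comp_bubble[OF permutes_comp_bubble[OF assms(1)]] ij assms(1)
    by simp
  moreover have "distinct ?vs"
    using ij(3) by (intro square_distinct[OF assms(1)]) simp
  ultimately show ?thesis
    unfolding cycles_def square_def by (intro CollectI exI[of _ ?vs]) simp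
qed

text \<open>The labels of four successive edges form a word equal to \<open>id\<close>, to which
  \<open>bubble_word_eq_id\<close> applies.\<close>

lemma cycles_4D:
  assumes "C \<in> cycles 4 (bubble_sort_graph n)"
  obtains \<pi> i j where "\<pi> permutes {1..n}" "(i, j) \<in> index_pairs n" "C = square \<pi> i j"
proof -
  obtain vs where vs: "C = cycle_of vs" "length vs = 4" "distinct vs"
    "set vs \<subseteq> verts (bubble_sort_graph n)" "edges (cycle_of vs) \<subseteq> edges (bubble_sort_graph n)"
    using assms by (auto simp: cycles_def)
  obtain a b c d where abcd: "vs = [a, b, c, d]"
    using vs(2) by (auto simp: numeral_eq_Suc length_Suc_conv)
  have perm: "a permutes {1..n}" "b permutes {1..n}" "c permutes {1..n}" "d permutes {1..n}"
    using vs(4) by (simp_all add: abcd)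
  have edges: "{a, b} \<in> edges (bubble_sort_graph n)" "{b, c} \<in> edges (bubble_sort_graph n)"
    "{c, d} \<in> edges (bubble_sort_graph n)" "{d, a} \<in> edges (bubble_sort_graph n)"
    using vs(5) by (simp_all add: abcd cycle_of_4)
  obtain i where i: "i \<in> {1..n - 1}" "b = a \<circ> bubble i"
    using edges(1) edge_bubble_sort_graph_iff[OF perm(1)] by blast
  obtain j where j: "j \<in> {1..n - 1}" "c = b \<circ> bubble j"
    using edges(2) edge_bubble_sort_graph_iff[OF perm(2)] by blast
  obtain k where k: "k \<in> {1..n - 1}" "d = c \<circ> bubble k"
    using edges(3) edge_bubble_sort_graph_iff[OF perm(3)] by blast
  obtain l where l: "l \<in> {1..n - 1}" "a = d \<circ> bubble l"
    using edges(4) edge_bubble_sort_graph_iff[OF perm(4)] by blast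
  have "a \<noteq> c" "b \<noteq> d"
    using vs(3) by (auto simp: abcd)
  \<comment> \<open>Two equal consecutive labels would cancel and identify opposite vertices; the
    same argument serves at each corner.\<close>
  have "i \<noteq> j"
    using \<open>a \<noteq> c\<close> i(2) j(2) by (metis comp_bubble_bubble)
  moreover have "j \<noteq> k"
    using \<open>b \<noteq> d\<close> j(2) k(2) by (metis comp_bubble_bubble)
  moreover have "k \<noteq> l"
    using \<open>a \<noteq> c\<close> k(2) l(2) by (metis comp_bubble_bubble)
  moreover have "l \<noteq> i"
    using \<open>b \<noteq> d\<close> l(2) i(2) by (metis comp_bubble_bubble)
  moreover have "a \<circ> (bubble i \<circ> bubble j \<circ> bubble k \<circ> bubble l) = a"
    unfolding comp_assoc[symmetric] using i(2) j(2) k(2) l(2) by metis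
  then have "bubble i \<circ> bubble j \<circ> bubble k \<circ> bubble l = id"
    using permutes_comp_left_cancel_id[OF perm(1)] by blast
  ultimately have kl: "k = i" "l = j" and far: "i + 1 < j \<or> j + 1 < i"
    using bubble_word_eq_id by blast+
  have "d = a \<circ> bubble j"
    using l(2) kl(2) by (metis comp_bubble_bubble)
  then have C: "C = square a i j"
    using vs(1) by (simp add: abcd i(2) j(2) square_def)
  \<comment> \<open>The first label need not be the smaller one; in the second case
    \<open>square_swap\<close> restores the order required by \<open>index_pairs\<close>.\<close>
  from far show ?thesis
  proof
    assume "i + 1 < j"
    then show ?thesis
      using i(1) j(1) by (intro that[OF perm(1) _ C]) (auto simp: index_pairs_def)
  next
    assume "j + 1 < i"
    then show ?thesis
      using i(1) j(1) C square_swap[OF \<open>j + 1 < i\<close>]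
      by (intro that[OF perm(1), of j i]) (auto simp: index_pairs_def)
  qed
qed

text \<open>A 4-cycle through \<pi> is a square based somewhere, and \<open>square_base\<close>
  moves its base point to \<pi>.\<close>

lemma cycles_4_through:
  assumes "\<pi> permutes {1..n}"
  shows "{C \<in> cycles 4 (bubble_sort_graph n). \<pi> \<in> verts C} = (\<lambda>(i, j). square \<pi> i j) ` index_pairs n"
proof (intro equalityI subsetI)
  fix C
  assume "C \<in> {C \<in> cycles 4 (bubble_sort_graph n). \<pi> \<in> verts C}"
  then have C: "C \<in> cycles 4 (bubble_sort_graph n)" "\<pi> \<in> verts C"
    by simp_all
  from C(1) obtain \<sigma> i j where "(i, j) \<in> index_pairs n" "C = square \<sigma> i j"
    by (rule cycles_4D)
  moreover from this C(2) have "square \<pi> i j = square \<sigma> i j"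
    by (intro square_base) (auto simp: index_pairs_def)
  ultimately show "C \<in> (\<lambda>(i, j). square \<pi> i j) ` index_pairs n"
    by (intro image_eqI[of _ _ "(i, j)"]) simp_all
next
  fix C
  assume "C \<in> (\<lambda>(i, j). square \<pi> i j) ` index_pairs n"
  then obtain i j where "(i, j) \<in> index_pairs n" "C = square \<pi> i j"
    by auto
  moreover have "\<pi> \<in> verts (square \<pi> i j)"
    by (simp add: square_def cycle_of_4)
  ultimately show "C \<in> {C \<in> cycles 4 (bubble_sort_graph n). \<pi> \<in> verts C}"
    using square_in_cycles[OF assms] by simp
qed

section \<open>Counting the 4-cycles\<close>

lemma card_cycles_4_through:
  assumes "\<pi> permutes {1..n}"
  shows "card {C \<in> cycles 4 (bubble_sort_graph n). \<pi> \<in> verts C} = card (index_pairs n)"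
proof -
  have "inj_on (\<lambda>(i, j). square \<pi> i j) (index_pairs n)"
  proof (rule inj_onI, clarify)
    fix i j i' j'
    assume ij: "(i, j) \<in> index_pairs n" "(i', j') \<in> index_pairs n"
      and "square \<pi> i j = square \<pi> i' j'"
    then have "{i, j} = {i', j'}"
      by (intro square_inj[OF assms]) (auto simp: index_pairs_def)
    with ij show "i = i' \<and> j = j'"
      by (auto simp: index_pairs_def doubleton_eq_iff)
  qed
  then show ?thesis
    by (simp add: cycles_4_through[OF assms] card_image)
qed

lemma finite_cycles_4: "finite (cycles 4 (bubble_sort_graph n))"
proof -
  have "cycles 4 (bubble_sort_graph n) \<subseteq>
      (\<lambda>(\<pi>, i, j). square \<pi> i j) ` ({\<pi>. \<pi> permutes {1..n}} \<times> index_pairs n)"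
  proof
    fix C
    assume "C \<in> cycles 4 (bubble_sort_graph n)"
    then obtain \<pi> i j where "\<pi> permutes {1..n}" "(i, j) \<in> index_pairs n" "C = square \<pi> i j"
      by (rule cycles_4D)
    then show "C \<in> (\<lambda>(\<pi>, i, j). square \<pi> i j) ` ({\<pi>. \<pi> permutes {1..n}} \<times> index_pairs n)"
      by (intro image_eqI[of _ _ "(\<pi>, i, j)"]) simp_all
  qed
  then show ?thesis
    by (rule finite_subset) (intro finite_imageI finite_cartesian_product finite_permutations
        finite_index_pairs finite_atLeastAtMost)
qed

text \<open>Double counting of incident pairs of a vertex and a 4-cycle: each cycle has four
  vertices, and each of the \<open>fact n\<close> vertices lies on
  \<open>card (index_pairs n)\<close> cycles.\<close>

lemma card_cycles_4: "4 * card (cycles 4 (bubble_sort_graph n)) = fact n * card (index_pairs n)"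
proof -
  let ?S = "{\<pi>. \<pi> permutes {1..n}}"
  have "card {\<pi> \<in> ?S. \<pi> \<in> verts C} = 4" if C: "C \<in> cycles 4 (bubble_sort_graph n)" for C
  proof -
    obtain vs where "C = cycle_of vs" "length vs = 4" "distinct vs" "set vs \<subseteq> ?S"
      using C by (auto simp: cycles_def)
    moreover from this have "{\<pi> \<in> ?S. \<pi> \<in> verts C} = set vs"
      by (auto simp: cycle_of_def)
    ultimately show ?thesis
      by (simp add: distinct_card)
  qed
  then have "(\<Sum>\<pi>\<in>?S. card {C \<in> cycles 4 (bubble_sort_graph n). \<pi> \<in> verts C})
      = 4 * card (cycles 4 (bubble_sort_graph n))"
    by (intro sum_multicount finite_cycles_4 finite_permutations finite_atLeastAtMost) blast
  moreover have "card ?S = fact n"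
    by (rule card_permutations) simp_all
  ultimately show ?thesis
    by (simp add: card_cycles_4_through)
qed

section \<open>Forms and canonical forms\<close>

lemma bubble_mult_simps [simp]:
  "bubble_mult n \<pi> [] = \<pi>"
  "bubble_mult n \<pi> (i # w) = bubble_mult n (\<pi> \<circ> bubble i) w"
  by (simp_all add: bubble_mult_def sym_group_def)

lemma bubble_walk_4:
  "bubble_walk n \<pi> [a, b, c, d] =
     [\<pi>, \<pi> \<circ> bubble a, \<pi> \<circ> bubble a \<circ> bubble b, \<pi> \<circ> bubble a \<circ> bubble b \<circ> bubble c]"
  by (simp add: bubble_walk_def upt_rec numeral_2_eq_2 numeral_3_eq_3)

lemma bubble_walk_square:
  assumes "i + 1 < j \<or> j + 1 < i"
  shows "bubble_walk n \<pi> [i, j, i, j] =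
     [\<pi>, \<pi> \<circ> bubble i, \<pi> \<circ> bubble i \<circ> bubble j, \<pi> \<circ> bubble j]"
proof -
  have "bubble i \<circ> bubble j = bubble j \<circ> bubble i"
    using assms bubble_commute by metis
  then have "\<pi> \<circ> bubble i \<circ> bubble j \<circ> bubble i = \<pi> \<circ> bubble j \<circ> bubble i \<circ> bubble i"
    by (simp add: comp_assoc)
  then show ?thesis
    by (simp add: bubble_walk_4)
qed

lemma square_is_form:
  assumes "\<pi> permutes {1..n}" "(i, j) \<in> index_pairs n"
  shows "is_form n (square \<pi> i j) [j, i, j, i]"
proof -
  have ij: "i + 1 < j" "1 \<le> i" "j < n"
    using assms(2) by (auto simp: index_pairs_def)
  have walk: "bubble_walk n \<pi> [j, i, j, i] =
      [\<pi>, \<pi> \<circ> bubble j, \<pi> \<circ> bubble j \<circ> bubble i, \<pi> \<circ> bubble i]"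
    using ij(1) by (intro bubble_walk_square) simp
  \<comment> \<open>Comparing last vertices in \<open>walk\<close> shows that three letters lead to
    \<open>\<pi> \<circ> bubble i\<close>, so the fourth letter closes the walk.\<close>
  have "bubble_mult n \<pi> [j, i, j, i] = \<pi>"
    using arg_cong[OF walk, of last] by (simp add: bubble_walk_4)
  moreover have "distinct (bubble_walk n \<pi> [j, i, j, i])"
    unfolding walk using ij by (intro square_distinct[OF assms(1)]) simp
  moreover have "cycle_of (bubble_walk n \<pi> [j, i, j, i]) = square \<pi> i j"
    using square_swap[OF ij(1), of \<pi>] by (simp add: walk square_def)
  moreover have "\<forall>k < length [j, i, j, i].
      [j, i, j, i] ! k \<noteq> [j, i, j, i] ! (Suc k mod length [j, i, j, i])"
    using ij by (auto simp: less_Suc_eq)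
  ultimately show ?thesis
    unfolding is_form_def using assms(1) ij by (auto simp: carrier_sym_group simp del: bubble_mult_simps)
qed

text \<open>The walk of a form lists the four vertices once, so the word has length four, and
  \<open>bubble_word_eq_id\<close> makes it alternate between two indices. Rebasing the square at
  the start \<sigma> of that walk lets \<open>square_inj\<close> identify them.\<close>

lemma square_formD:
  assumes "\<pi> permutes {1..n}" "(i, j) \<in> index_pairs n" "is_form n (square \<pi> i j) w"
  shows "w = [i, j, i, j] \<or> w = [j, i, j, i]"
proof -
  have ij: "i + 1 < j"
    using assms(2) by (auto simp: index_pairs_def)
  obtain \<sigma> where \<sigma>: "\<sigma> permutes {1..n}" "bubble_mult n \<sigma> w = \<sigma>"
      "distinct (bubble_walk n \<sigma> w)" "cycle_of (bubble_walk n \<sigma> w) = square \<pi> i j"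
    and adj: "\<forall>k < length w. w ! k \<noteq> w ! (Suc k mod length w)"
    using assms(3) by (auto simp: is_form_def carrier_sym_group)
  have verts: "set (bubble_walk n \<sigma> w) = verts (square \<pi> i j)"
    using arg_cong[OF \<sigma>(4), of fst] by (simp add: cycle_of_def)
  have "length w = length (bubble_walk n \<sigma> w)"
    by (simp add: bubble_walk_def)
  also have "\<dots> = card (verts (square \<pi> i j))"
    using distinct_card[OF \<sigma>(3)] verts by simp
  also have "\<dots> = card (set [\<pi>, \<pi> \<circ> bubble i, \<pi> \<circ> bubble i \<circ> bubble j, \<pi> \<circ> bubble j])"
    by (simp add: square_def cycle_of_def)
  also have "\<dots> = 4"
    using distinct_card[OF square_distinct[OF assms(1), of i j]] ij by simp
  finally have len: "length w = 4" .
  then obtain a b c d where w: "w = [a, b, c, d]"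
    by (auto simp: numeral_eq_Suc length_Suc_conv)
  have "\<sigma> \<circ> (bubble a \<circ> bubble b \<circ> bubble c \<circ> bubble d) = \<sigma>"
    using \<sigma>(2) by (simp add: w comp_assoc)
  then have "bubble a \<circ> bubble b \<circ> bubble c \<circ> bubble d = id"
    using permutes_comp_left_cancel_id[OF \<sigma>(1)] by blast
  moreover have "a \<noteq> b" "b \<noteq> c" "c \<noteq> d" "d \<noteq> a"
    using adj[unfolded w, rule_format, of 0] adj[unfolded w, rule_format, of 1]
      adj[unfolded w, rule_format, of 2] adj[unfolded w, rule_format, of 3]
    by simp_all
  ultimately have cd: "c = a" "d = b" and far: "a + 1 < b \<or> b + 1 < a"
    using bubble_word_eq_id by blast+
  have "square \<sigma> a b = square \<pi> i j"
    using \<sigma>(4) bubble_walk_square[OF far] by (simp add: w cd square_def)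
  \<comment> \<open>The walk starts at \<sigma>, so \<sigma> is a vertex of the square.\<close>
  also have "\<dots> = square \<sigma> i j"
    using verts by (intro square_base[OF ij, symmetric]) (auto simp: w bubble_walk_4)
  finally have "{a, b} = {i, j}"
    using \<open>a \<noteq> b\<close> ij by (intro square_inj[OF \<sigma>(1)]) simp_all
  then show ?thesis
    by (auto simp: w cd doubleton_eq_iff)
qed

text \<open>All choices of start and direction yield only two words, and the one beginning with the
  larger index \<open>j\<close> is lexicographically maximal.\<close>

lemma square_canonical_form:
  assumes "\<pi> permutes {1..n}" "(i, j) \<in> index_pairs n"
  shows "is_canonical_form n (square \<pi> i j) [j, i, j, i]"
  unfolding is_canonical_form_def
proof (intro conjI allI impI)
  show "is_form n (square \<pi> i j) [j, i, j, i]"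
    using assms by (rule square_is_form)
next
  fix w
  assume "is_form n (square \<pi> i j) w"
  then have "w = [i, j, i, j] \<or> w = [j, i, j, i]"
    by (rule square_formD[OF assms])
  then show "w = [j, i, j, i] \<or> (w, [j, i, j, i]) \<in> lexord less_than"
    using assms(2) by (auto simp: index_pairs_def)
qed

theorem theorem1:
  fixes n :: nat
  assumes "n \<ge> 4"
  shows "(\<forall>\<pi> \<in> verts (bubble_sort_graph n).
            real (card {C \<in> cycles 4 (bubble_sort_graph n). \<pi> \<in> verts C})
              = (real n - 2) * (real n - 3) / 2) \<and>
         (\<forall>C \<in> cycles 4 (bubble_sort_graph n).
            \<exists>i j. 1 \<le> i \<and> i < j - 1 \<and> j - 1 \<le> n - 2 \<and>
              is_canonical_form n C (concat (replicate 2 [j, i]))) \<and>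
         real (card (cycles 4 (bubble_sort_graph n)))
           = (real n - 2) * (real n - 3) * fact n / 8"
proof (intro conjI ballI)
  \<comment> \<open>The bound on \<open>n\<close> rules out truncation, so the count on natural
    numbers carries over to the reals.\<close>
  have "n - 2 + 2 = n" "n - 2 - 1 = n - 3"
    using assms by simp_all
  then have "2 * card (index_pairs n) = (n - 2) * (n - 3)"
    using card_index_pairs[of "n - 2"] by metis
  then have "2 * real (card (index_pairs n)) = real ((n - 2) * (n - 3))"
    by linarith
  then have pairs: "real (card (index_pairs n)) = (real n - 2) * (real n - 3) / 2"
    using assms by (simp add: of_nat_diff)
  show "real (card {C \<in> cycles 4 (bubble_sort_graph n). \<pi> \<in> verts C})
      = (real n - 2) * (real n - 3) / 2" if "\<pi> \<in> verts (bubble_sort_graph n)" for \<pi>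
    using that card_cycles_4_through[of \<pi> n] pairs by simp
  \<comment> \<open>The divisor 8 combines the four vertices of a cycle with the factor 2 in
    \<open>pairs\<close>.\<close>
  show "real (card (cycles 4 (bubble_sort_graph n))) = (real n - 2) * (real n - 3) * fact n / 8"
    using arg_cong[OF card_cycles_4[of n], of real] pairs by (simp add: field_simps)
next
  fix C
  assume "C \<in> cycles 4 (bubble_sort_graph n)"
  then obtain \<pi> i j where "\<pi> permutes {1..n}" and ij: "(i, j) \<in> index_pairs n"
    and "C = square \<pi> i j"
    by (rule cycles_4D)
  then have "is_canonical_form n C [j, i, j, i]"
    using square_canonical_form by blast
  moreover have "concat (replicate 2 [j, i]) = [j, i, j, i]"
    by (simp add: numeral_2_eq_2)
  ultimately have "is_canonical_form n C (concat (replicate 2 [j, i]))"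
    by simp
  then show "\<exists>i j. 1 \<le> i \<and> i < j - 1 \<and> j - 1 \<le> n - 2 \<and>
      is_canonical_form n C (concat (replicate 2 [j, i]))"
    using ij by (intro exI[of _ i] exI[of _ j]) (auto simp: index_pairs_def)
qed

end
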